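(* Let $K\ge 1$ be an integer and let $S(L)$ denote the expected number of slots used by the $K$-threshold binary splitting protocol (defined in the context) to resolve $L$ contending users. Put $$\alpha^* = 1+\frac{1}{K},\qquad \beta^* = 1 + \frac{1}{(K+1)(2^K-1)} + \frac{2}{K+1} + \frac{1}{K}.$$ Then $S(L)=L$ if $1\le L\le K$, and for every integer $L>K$ $$\alpha^* L - 1 \le S(L) \le \beta^* L - 1 .$$
   Context: The $K$-threshold binary splitting protocol (contention resolution with parameter $K\ge1$) acts on a finite set of contending users, of size $L$, as follows. In the first slot all $L$ users transmit simultaneously. - If $L=0$, the slot is idle and the procedure ends; an empty group uses exactly one slot. - If $1\le L\le K$, the receiver learns exactly which users are active, together with the (finite-field) sum of their messages. In the next $L-1$ slots, $L-1$ of the users are scheduled to transmit individually, after which all $L$ messages are known and the procedure ends. In total $L$ slots are used. - If $L>K$, this first slot is spent without resolving any user. Each of the $L$ users then independently flips a fair coin to join group 1 or group 2. The same procedure is applied recursively, first to group 1 and, once it ends, to group 2 (with fresh independent coin flips at each split). The number of slots used is one plus the numbers of slots used by the two recursive executions. $S(L)$ is the expected total number of slots used when starting with $L$ users, the expectation being over all the coin flips. *)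

theory Defs
  imports "HOL-Probability.Probability"
begin

text \<open>
  \<open>protocol K A\<close> is the distribution of the number of slots used by the \<open>K\<close>-threshold
  binary splitting protocol on the finite set \<open>A\<close> of contending users.  The recursion need
  not terminate on every sequence of coin flips, so the distribution is the least fixed point in
  the subprobability mass functions; non-terminating runs correspond to the outcome \<open>None\<close>.
\<close>

partial_function (spmf) protocol :: "nat \<Rightarrow> nat set \<Rightarrow> nat spmf" where
  "protocol K A =
     (if A = {} then return_spmf 1
      else if card A \<le> K then return_spmf (card A)
      else do {
        coin \<leftarrow> spmf_of_pmf (Pi_pmf A False (\<lambda>_. bernoulli_pmf (1 / 2)));
        t1 \<leftarrow> protocol K {u \<in> A. coin u};
        t2 \<leftarrow> protocol K {u \<in> A. \<not> coin u};
        return_spmf (1 + t1 + t2)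
      })"

text \<open>
  The expectation is taken in \<^typ>\<open>ennreal\<close>, and a non-terminating run counts as using
  infinitely many slots; hence a finite upper bound on \<open>S K L\<close> entails almost sure
  termination.  The users are, without loss of generality, the numbers below \<open>L\<close>.
\<close>

definition S :: "nat \<Rightarrow> nat \<Rightarrow> ennreal" where
  "S K L = (\<integral>\<^sup>+ r. (case r of None \<Rightarrow> \<infinity> | Some t \<Rightarrow> of_nat t) \<partial>measure_pmf (protocol K {..<L}))"

definition alpha_star :: "nat \<Rightarrow> real" where
  "alpha_star K = 1 + 1 / real K"

definition beta_star :: "nat \<Rightarrow> real" where
  "beta_star K = 1 + 1 / ((real K + 1) * (2 ^ K - 1)) + 2 / (real K + 1) + 1 / real K"

end

theory Submission
  imports Defs
begin

text \<open>
  Adding 1 to the cost turns the recursion into one whose split step is additive, so bounds of the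
  form \<open>c L - 1\<close> propagate through a split. The lower bound holds for every outcome of the coins.
  For the upper bound, the defects at group sizes \<open>i \<le> K\<close> have to cancel on average, which amounts to
  \<open>1 + (\<Sum>i\<le>K. L choose i) \<le> (\<beta>\<^sup>* - 1) (\<Sum>i\<le>K. i (L choose i))\<close>. With \<open>m = L - 1\<close> and
  \<open>T = (\<Sum>j<K. m choose j)\<close> this reads \<open>1 + 2 T + (m choose K) \<le> (\<beta>\<^sup>* - 1) (m + 1) T\<close>, and the three
  summands of \<open>\<beta>\<^sup>* - 1\<close> pay for the three summands on the left. Since the protocol is a least fixed
  point, a supersolution of the recursion bounds the cost of its terminating runs; termination is
  shown separately.
\<close>

section \<open>Truncated binomial sums and \<open>beta_star\<close>\<close>

lemma binomial_mono_left: "m \<le> n \<Longrightarrow> m choose k \<le> n choose k"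
proof (induction n arbitrary: k)
  case (Suc n)
  then show ?case by (cases k) (auto simp: le_Suc_eq intro: trans_le_add2)
qed simp

text \<open>The left side is the value at \<open>m = K\<close>: the full row sums to
  \<open>2 ^ K\<close>, and its last entry 1 is left out. This is the source of the factor
  \<open>2 ^ K - 1\<close> in \<open>beta_star\<close>.\<close>

lemma sum_binomial_truncated_ge:
  assumes "K \<le> m"
  shows "2 ^ K - 1 \<le> (\<Sum>j<K. real (m choose j))"
proof -
  have "(\<Sum>j\<le>K. real (K choose j)) = 2 ^ K"
    by (metis choose_row_sum of_nat_numeral of_nat_power of_nat_sum)
  then have "2 ^ K - 1 = (\<Sum>j<K. real (K choose j))"
    by (simp flip: lessThan_Suc_atMost)
  also have "\<dots> \<le> (\<Sum>j<K. real (m choose j))"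
    by (intro sum_mono) (simp add: binomial_mono_left assms)
  finally show ?thesis .
qed

lemma sum_binomial_Suc_truncated:
  "(\<Sum>i\<le>K. real (Suc m choose i)) = 2 * (\<Sum>j<K. real (m choose j)) + real (m choose K)"
proof -
  have "(\<Sum>i\<le>K. real (Suc m choose i))
      = (\<Sum>j<K. real (m choose j)) + (1 + (\<Sum>j<K. real (m choose Suc j)))"
    by (simp add: sum.atMost_shift sum.distrib)
  also have "1 + (\<Sum>j<K. real (m choose Suc j)) = (\<Sum>i\<le>K. real (m choose i))"
    by (simp add: sum.atMost_shift)
  finally show ?thesis by (simp flip: lessThan_Suc_atMost)
qed

lemma sum_weighted_binomial_Suc_truncated:
  "(\<Sum>i\<le>K. real i * real (Suc m choose i)) = real (Suc m) * (\<Sum>j<K. real (m choose j))"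
proof -
  have "real (Suc j) * real (Suc m choose Suc j) = real (Suc m) * real (m choose j)" for j
    by (metis Suc_times_binomial of_nat_mult)
  then show ?thesis
    unfolding sum.atMost_shift sum_distrib_left
    by (simp del: binomial_Suc_Suc of_nat_Suc)
qed

text \<open>\<open>K (m choose K) <= K (m + 1 choose K) = (m + 1) (m choose K - 1)\<close> by
  absorption, and the last factor is a single summand of the truncated sum.\<close>

lemma binomial_last_le_truncated_sum:
  assumes "1 \<le> K"
  shows "real (m choose K) \<le> real (Suc m) * (\<Sum>j<K. real (m choose j)) / real K"
proof -
  obtain k where K: "K = Suc k" using assms by (cases K) auto
  have "real K * real (m choose K) \<le> real (Suc k) * real (Suc m choose Suc k)"
    unfolding K by (intro mult_left_mono) (simp_all add: binomial_mono_left)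
  also have "\<dots> = real (Suc m) * real (m choose k)"
    by (metis Suc_times_binomial of_nat_mult)
  also have "\<dots> \<le> real (Suc m) * (\<Sum>j<K. real (m choose j))"
    by (intro mult_left_mono member_le_sum) (auto simp: K)
  finally show ?thesis using assms by (simp add: field_simps)
qed

lemma beta_star_binomial_bound:
  assumes "1 \<le> K" "K < n"
  shows "1 + (\<Sum>i\<le>K. real (n choose i)) \<le> (beta_star K - 1) * (\<Sum>i\<le>K. real i * real (n choose i))"
proof -
  obtain m where n: "n = Suc m" and m: "K \<le> m" using assms by (cases n) auto
  define T where "T = (\<Sum>j<K. real (m choose j))"
  \<comment> \<open>\<open>K < n\<close> makes \<open>c\<close> at least 1; multiplying by
    \<open>c\<close> creates the \<open>(m + 1) / (K + 1)\<close> that belongs to the first two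
    fractions in \<open>beta_star\<close>.\<close>
  define c where "c = (real m + 1) / (real K + 1)"
  have pos: "(2::real) ^ K - 1 > 0" using assms by simp
  have T: "2 ^ K - 1 \<le> T" unfolding T_def by (rule sum_binomial_truncated_ge[OF m])
  have c: "1 \<le> c" using m by (simp add: c_def)
  have "1 \<le> T / (2 ^ K - 1)" using T pos by simp
  then have "1 + 2 * T \<le> 1 * (T / (2 ^ K - 1) + 2 * T)" by simp
  also have "\<dots> \<le> c * (T / (2 ^ K - 1) + 2 * T)"
    using c T pos by (intro mult_right_mono) auto
  finally have "1 + 2 * T + real (m choose K)
      \<le> c * (T / (2 ^ K - 1) + 2 * T) + (real m + 1) * T / real K"
    using binomial_last_le_truncated_sum[OF assms(1), of m] by (simp add: T_def add.commute)
  also have "\<dots> = (beta_star K - 1) * ((real m + 1) * T)"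
    using pos assms(1) unfolding beta_star_def c_def
    by (simp add: distrib_left distrib_right add_divide_distrib)
  finally show ?thesis
    unfolding n sum_binomial_Suc_truncated sum_weighted_binomial_Suc_truncated T_def[symmetric]
    by (simp add: add.commute)
qed

section \<open>The upper bound as a supersolution of the split recursion\<close>

text \<open>The value 1 at 0 is the idle slot of an empty group; the line used for large groups
  would give -1 there.\<close>

definition slot_bound :: "nat \<Rightarrow> nat \<Rightarrow> real" where
  "slot_bound K n =
     (if n = 0 then 1 else if n \<le> K then real n else beta_star K * real n - 1)"

lemma beta_star_ge_1: "1 \<le> beta_star K"
proof -
  have "(1::real) \<le> 2 ^ K" by simp
  then show ?thesis unfolding beta_star_def by simp
qed

lemma slot_bound_nonneg: "0 \<le> slot_bound K n"
proof (cases "n = 0")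
  case False
  then have "1 * 1 \<le> beta_star K * real n" using beta_star_ge_1[of K] by (intro mult_mono) auto
  then show ?thesis by (simp add: slot_bound_def)
qed (simp add: slot_bound_def)

lemma slot_bound_split:
  assumes "1 \<le> K" "K < n"
  shows "(\<Sum>k\<le>n. real (n choose k) * (1 + slot_bound K k + slot_bound K (n - k)))
           \<le> 2 ^ n * slot_bound K n"
proof -
  \<comment> \<open>\<open>e\<close> is the defect against the line with slope
    \<open>b = beta_star K\<close>. As \<open>1 + (b k - 1) + (b (n - k) - 1) = b n - 1\<close>, the
    line passes through a split unchanged and only the defects remain; they vanish above
    \<open>K\<close>.\<close>
  define e where "e k = slot_bound K k - (beta_star K * real k - 1)" for k
  have "(\<Sum>k\<le>n. real (n choose k) * e k) = (\<Sum>k\<le>K. real (n choose k) * e k)"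
    using assms(2) by (intro sum.mono_neutral_right) (auto simp: e_def slot_bound_def)
  \<comment> \<open>\<open>e 0 = 2\<close> is one more than the general formula gives at 0; this
    extra 1 is the leading 1 in \<open>beta_star_binomial_bound\<close>.\<close>
  also have "\<dots> = (\<Sum>k\<le>K. real (n choose k) - (beta_star K - 1) * (real k * real (n choose k))
                      + (if k = 0 then 1 else 0))"
    by (intro sum.cong) (auto simp: e_def slot_bound_def algebra_simps)
  also have "\<dots> \<le> 0"
    using beta_star_binomial_bound[OF assms]
    by (simp add: sum.distrib sum_subtractf flip: sum_distrib_left)
  finally have e: "(\<Sum>k\<le>n. real (n choose k) * e k) \<le> 0" .
  have rev: "(\<Sum>k\<le>n. real (n choose k) * e (n - k)) = (\<Sum>k\<le>n. real (n choose k) * e k)"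
    by (rule sum.reindex_bij_witness[where i = "\<lambda>k. n - k" and j = "\<lambda>k. n - k"])
       (auto simp flip: binomial_symmetric)
  have total: "(\<Sum>k\<le>n. real (n choose k)) = 2 ^ n"
    by (metis choose_row_sum of_nat_numeral of_nat_power of_nat_sum)
  have "real (n choose k) * (1 + slot_bound K k + slot_bound K (n - k))
      = real (n choose k) * slot_bound K n + real (n choose k) * e k + real (n choose k) * e (n - k)"
    if "k \<le> n" for k
  proof -
    have "1 + slot_bound K k + slot_bound K (n - k) = slot_bound K n + e k + e (n - k)"
      using that assms(2) by (simp add: e_def slot_bound_def[of K n] of_nat_diff algebra_simps)
    then show ?thesis by (simp add: algebra_simps)
  qed
  then have "(\<Sum>k\<le>n. real (n choose k) * (1 + slot_bound K k + slot_bound K (n - k)))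
      = 2 ^ n * slot_bound K n + 2 * (\<Sum>k\<le>n. real (n choose k) * e k)"
    by (simp add: sum.distrib rev total flip: sum_distrib_right)
  with e show ?thesis by simp
qed

definition fair_coins :: "'a set \<Rightarrow> ('a \<Rightarrow> bool) pmf" where
  "fair_coins A = Pi_pmf A False (\<lambda>_. bernoulli_pmf (1 / 2))"

lemma card_split: "finite A \<Longrightarrow> card {u \<in> A. \<not> c u} = card A - card {u \<in> A. c u}"
  by (subst card_Diff_subset[symmetric]) (auto intro: arg_cong[where f = card])

text \<open>The integrand depends only on the size of group 1, which is binomial with parameter 1/2,
  so this is \<open>slot_bound_split\<close> divided by \<open>2 ^ card A\<close>.\<close>

lemma slot_bound_fair_coins:
  assumes "1 \<le> K" "K < card A" "finite A"
  shows "(\<integral>\<^sup>+ c. ennreal (1 + slot_bound K (card {u \<in> A. c u}) + slot_bound K (card {u \<in> A. \<not> c u}))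
            \<partial>measure_pmf (fair_coins A)) \<le> ennreal (slot_bound K (card A))"
    (is "?I \<le> _")
proof -
  define n where "n = card A"
  define g where "g k = 1 + slot_bound K k + slot_bound K (n - k)" for k
  have g: "0 \<le> g k" for k by (simp add: g_def slot_bound_nonneg)
  have "?I = (\<integral>\<^sup>+ k. ennreal (g k)
               \<partial>measure_pmf (map_pmf (\<lambda>c. card {u \<in> A. c u}) (fair_coins A)))"
    using assms(3) by (simp add: g_def n_def card_split)
  also have "map_pmf (\<lambda>c. card {u \<in> A. c u}) (fair_coins A) = binomial_pmf n (1 / 2)"
    unfolding fair_coins_def using assms(3) n_def by (subst binomial_pmf_altdef'[of A n]) auto
  also have "(\<integral>\<^sup>+ k. ennreal (g k) \<partial>measure_pmf (binomial_pmf n (1 / 2)))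
      = ennreal (measure_pmf.expectation (binomial_pmf n (1 / 2)) g)"
    by (intro nn_integral_eq_integral) (auto simp: g)
  also have "measure_pmf.expectation (binomial_pmf n (1 / 2)) g
      = (\<Sum>k\<le>n. real (n choose k) * g k) / 2 ^ n"
    by (simp add: expectation_binomial_pmf' sum_divide_distrib power_one_over
             flip: power_add)
  also have "\<dots> \<le> slot_bound K n"
    using slot_bound_split[OF assms(1,2)] by (simp add: g_def n_def divide_simps mult.commute)
  finally show ?thesis by (simp add: n_def ennreal_leI)
qed

section \<open>Expected slots of terminating runs\<close>

text \<open>Unlike in \<^const>\<open>S\<close>, non-terminating runs contribute 0, which makes \<open>cost\<close> continuous.\<close>

definition cost :: "nat spmf \<Rightarrow> ennreal" where
  "cost p = (\<integral>\<^sup>+ t. of_nat t \<partial>measure_spmf p)"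

lemma cost_return [simp]: "cost (return_spmf t) = of_nat t"
  by (simp add: cost_def measure_spmf_return_spmf nn_integral_return)

lemma cost_return_None [simp]: "cost (return_pmf None) = 0"
  by (simp add: cost_def measure_spmf_return_pmf_None)

lemma cost_bind_pmf: "cost (spmf_of_pmf q \<bind> f) = (\<integral>\<^sup>+ x. cost (f x) \<partial>measure_pmf q)"
  unfolding cost_def measure_spmf_bind measure_spmf_spmf_of_pmf
  by (subst nn_integral_bind[where B = "count_space UNIV"]) auto

lemma cost_bind: "cost (p \<bind> f) = (\<integral>\<^sup>+ x. cost (f x) \<partial>measure_spmf p)"
  unfolding cost_def measure_spmf_bind 
  by (subst nn_integral_bind[where B = "count_space UNIV"]) auto

definition split_slots :: "nat spmf \<Rightarrow> nat spmf \<Rightarrow> nat spmf" where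
  "split_slots p q = p \<bind> (\<lambda>t1. q \<bind> (\<lambda>t2. return_spmf (1 + t1 + t2)))"

lemma nn_integral_const_add_spmf:
  "(\<integral>\<^sup>+ t. c + of_nat t \<partial>measure_spmf p) = c * emeasure (measure_spmf p) UNIV + cost p"
  by (simp add: cost_def nn_integral_add space_measure_spmf)

text \<open>A run of \<open>p\<close> contributes its own slots only if \<open>q\<close> terminates
  too, hence the mass of \<open>q\<close> as a factor.\<close>

lemma cost_split_slots_conv:
  "cost (split_slots p q) =
     (\<integral>\<^sup>+ t. (1 + of_nat t) * emeasure (measure_spmf q) UNIV + cost q \<partial>measure_spmf p)"
  unfolding split_slots_def cost_bind nn_integral_const_add_spmf[symmetric]
  by (simp del: of_nat_Suc add: cost_bind ac_simps flip: of_nat_Suc of_nat_add)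

text \<open>Masses are at most 1. An inequality is enough for fixed-point induction, whose
  approximations may lose mass.\<close>

lemma cost_split_slots_le: "cost (split_slots p q) \<le> 1 + cost p + cost q"
proof -
  have w: "c * emeasure (measure_spmf r) UNIV \<le> c" for c and r :: "nat spmf"
    using mult_left_mono[OF measure_spmf.subprob_emeasure_le_1[of r UNIV], of c] by simp
  have "cost (split_slots p q) \<le> (\<integral>\<^sup>+ t. (1 + cost q) + of_nat t \<partial>measure_spmf p)"
    unfolding cost_split_slots_conv
    using add_right_mono[OF w, of _ q "cost q"] by (intro nn_integral_mono) (simp add: ac_simps)
  also have "\<dots> \<le> (1 + cost q) + cost p"
    unfolding nn_integral_const_add_spmf by (intro add_right_mono w)
  finally show ?thesis by (simp add: ac_simps)
qed

lemma cost_split_slots: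
  assumes "lossless_spmf p" "lossless_spmf q"
  shows "cost (split_slots p q) = 1 + cost p + cost q"
proof -
  have w: "emeasure (measure_spmf r) UNIV = 1" if "lossless_spmf r" for r :: "nat spmf"
    using that by (simp add: measure_spmf.emeasure_eq_measure lossless_spmf_def weight_spmf_def)
  have "cost (split_slots p q) = (\<integral>\<^sup>+ t. (1 + cost q) + of_nat t \<partial>measure_spmf p)"
    unfolding cost_split_slots_conv w[OF assms(2)] by (simp add: ac_simps)
  then show ?thesis
    unfolding nn_integral_const_add_spmf w[OF assms(1)] by (simp add: ac_simps)
qed

text \<open>Monotone convergence: along the chain the mass of every outcome grows. The chain need
  not be a sequence, but the outcomes are countable.\<close>

lemma cost_lub_spmf:
  assumes Y: "Y \<noteq> {}" and chain: "Complete_Partial_Order.chain (ord_spmf (=)) Y"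
  shows "cost (lub_spmf Y) = (SUP p\<in>Y. cost p)"
proof -
  have "cost (lub_spmf Y)
      = (\<integral>\<^sup>+ t. (SUP p\<in>Y. ennreal (spmf p t) * of_nat t) \<partial>count_space UNIV)"
    unfolding cost_def nn_integral_measure_spmf
    by (simp add: ennreal_spmf_lub_spmf[OF chain Y] SUP_mult_right_ennreal)
  also have "\<dots> = (SUP p\<in>Y. \<integral>\<^sup>+ t. ennreal (spmf p t) * of_nat t \<partial>count_space UNIV)"
  proof (rule nn_integral_monotone_convergence_SUP_countable[OF Y])
    have "Complete_Partial_Order.chain (\<le>)
            ((\<lambda>f t. f t * of_nat t) ` (\<lambda>p t. ennreal (spmf p t)) ` Y)"
      using chain_ord_spmf_eqD[OF chain]
      by (rule chain_imageI) (auto simp: le_fun_def intro: mult_right_mono)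
    then show "Complete_Partial_Order.chain (\<le>) ((\<lambda>p t. ennreal (spmf p t) * of_nat t) ` Y)"
      by (simp add: image_image)
  qed simp
  finally show ?thesis by (simp add: cost_def nn_integral_measure_spmf)
qed

lemma admissible_cost_le: "ccpo.admissible lub_spmf (ord_spmf (=)) (\<lambda>p. cost p \<le> b)"
  by (rule ccpo.admissibleI) (auto simp: cost_lub_spmf intro: SUP_least)

lemma admissible_cost_apply_le: "spmf.admissible (\<lambda>f. cost (f x) \<le> b)"
proof -
  \<comment> \<open>Admissibility for functions is obtained pointwise at all arguments, so the
    arguments other than \<open>x\<close> get the trivial bound \<open>\<top>\<close>.\<close>
  have "spmf.admissible (\<lambda>f. \<forall>y. cost (f y) \<le> (if y = x then b else \<top>))"
    by (intro admissible_fun partial_function_definitions_spmf admissible_cost_le)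
  moreover have "(\<forall>y. cost (f y) \<le> (if y = x then b else \<top>)) \<longleftrightarrow> cost (f x) \<le> b" for f
    by auto
  ultimately show ?thesis by simp
qed

section \<open>Upper bound by fixed-point induction\<close>

lemma protocol_split:
  assumes "K < card A"
  shows "protocol K A = spmf_of_pmf (fair_coins A) \<bind>
           (\<lambda>c. split_slots (protocol K {u \<in> A. c u}) (protocol K {u \<in> A. \<not> c u}))"
  using assms by (subst protocol.simps) (auto simp: fair_coins_def split_slots_def)

lemma protocol_empty [simp]: "protocol K {} = return_spmf 1"
  by (subst protocol.simps) simp

lemma protocol_small: "A \<noteq> {} \<Longrightarrow> card A \<le> K \<Longrightarrow> protocol K A = return_spmf (card A)"
  by (subst protocol.simps) simp

text \<open>A split may return all of \<open>A\<close> as one group, so the induction is on the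
  approximations of the fixed point, starting from nontermination with cost 0;
  \<open>slot_bound_fair_coins\<close> carries the bound through one unfolding.\<close>

lemma cost_protocol_le:
  assumes "1 \<le> K" "finite A"
  shows "cost (protocol K A) \<le> ennreal (slot_bound K (card A))"
proof -
  have "\<forall>A. finite A \<longrightarrow> cost (protocol K A) \<le> ennreal (slot_bound K (card A))"
  proof (rule protocol.fixp_induct[where P =
      "\<lambda>f. \<forall>A. finite A \<longrightarrow> cost (f K A) \<le> ennreal (slot_bound K (card A))"], goal_cases)
    case 1
    show ?case
      unfolding curry_def by (intro admissible_all admissible_imp admissible_cost_apply_le)
  next
    case 2
    show ?case by simp
  next
    case (3 f)
    show ?case
    proof (intro allI impI)
      fix A :: "nat set"
      assume A: "finite A"
      have f: "cost (f K B) \<le> ennreal (slot_bound K (card B))" if "finite B" for B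
        using 3 that by blast
      have step: "cost (spmf_of_pmf (fair_coins A) \<bind>
          (\<lambda>c. split_slots (f K {u \<in> A. c u}) (f K {u \<in> A. \<not> c u}))) \<le> ennreal (slot_bound K (card A))"
        if "K < card A"
      proof -
        have "cost (split_slots (f K {u \<in> A. c u}) (f K {u \<in> A. \<not> c u}))
            \<le> ennreal (1 + slot_bound K (card {u \<in> A. c u}) + slot_bound K (card {u \<in> A. \<not> c u}))" for c
        proof -
          have "cost (split_slots (f K {u \<in> A. c u}) (f K {u \<in> A. \<not> c u}))
              \<le> 1 + cost (f K {u \<in> A. c u}) + cost (f K {u \<in> A. \<not> c u})"
            by (rule cost_split_slots_le)
          also have "\<dots> \<le> 1 + ennreal (slot_bound K (card {u \<in> A. c u}))
                           + ennreal (slot_bound K (card {u \<in> A. \<not> c u}))"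
            using A by (intro add_mono f order_refl) auto
          finally show ?thesis by (simp add: slot_bound_nonneg ennreal_plus)
        qed
        then show ?thesis
          unfolding cost_bind_pmf
          by (rule order_trans[OF nn_integral_mono slot_bound_fair_coins[OF assms(1) that A]])
      qed
      show "cost (if A = {} then return_spmf 1
              else if card A \<le> K then return_spmf (card A)
              else spmf_of_pmf (Pi_pmf A False (\<lambda>_. bernoulli_pmf (1 / 2))) \<bind>
                (\<lambda>coin. f K {u \<in> A. coin u} \<bind>
                  (\<lambda>t1. f K {u \<in> A. \<not> coin u} \<bind> (\<lambda>t2. return_spmf (1 + t1 + t2)))))
            \<le> ennreal (slot_bound K (card A))"
      proof (cases "K < card A")
        case True
        then show ?thesis using step by (auto simp: fair_coins_def split_slots_def)
      next
        case False
        then show ?thesis using A by (auto simp: slot_bound_def ennreal_of_nat_eq_real_of_nat)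
      qed
    qed
  qed
  then show ?thesis using assms(2) by blast
qed

section \<open>Almost sure termination\<close>

lemma lossless_split_slots:
  "lossless_spmf p \<Longrightarrow> lossless_spmf q \<Longrightarrow> lossless_spmf (split_slots p q)"
  by (simp add: split_slots_def)

text \<open>This serves the splits that leave one group empty: such a group terminates, so only the
  other one can fail.\<close>

lemma pmf_None_split_slots_return:
  "pmf (split_slots p (return_spmf t)) None = pmf p None"
  "pmf (split_slots (return_spmf t) p) None = pmf p None"
  by (simp_all add: split_slots_def pmf_bind_spmf_None)

text \<open>
  A split leaves all users together with probability less than 1, so the probability
  \<open>x\<close> of non-termination satisfies \<open>x \<le> x * q\<close> with \<open>q < 1\<close>.
\<close>

lemma lossless_protocol:
  assumes "1 \<le> K" "finite A"
  shows "lossless_spmf (protocol K A)"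
  using assms(2)
proof (induction A rule: finite_psubset_induct)
  case (psubset A)
  show ?case
  proof (cases "K < card A")
    case False
    then show ?thesis by (cases "A = {}") (simp_all add: protocol_small)
  next
    case True
    define x where "x = pmf (protocol K A) None"
    define g where
      "g c = pmf (split_slots (protocol K {u \<in> A. c u}) (protocol K {u \<in> A. \<not> c u})) None" for c
    define G where "G = {c. {u \<in> A. c u} \<subset> A \<and> {u \<in> A. \<not> c u} \<subset> A}"
    have good: "g c = 0" if "c \<in> G" for c
      using that psubset.IH lossless_split_slots unfolding g_def G_def
      by (auto simp flip: lossless_iff_pmf_None)
    have bad: "g c = x" if "c \<notin> G" for c
    proof -
      from that consider "{u \<in> A. c u} = A" "{u \<in> A. \<not> c u} = {}"
        | "{u \<in> A. c u} = {}" "{u \<in> A. \<not> c u} = A"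
        unfolding G_def by blast
      then show ?thesis
        unfolding g_def x_def
        by cases (simp_all only: protocol_empty pmf_None_split_slots_return)
    qed
    have "x = measure_pmf.expectation (fair_coins A) g"
      unfolding x_def g_def by (subst protocol_split[OF True]) (simp add: pmf_bind)
    also have "\<dots> = measure_pmf.expectation (fair_coins A) (\<lambda>c. x * indicator (- G) c)"
      using good bad by (intro arg_cong[where f = "integral\<^sup>L _"]) (auto simp: indicator_def)
    also have "\<dots> = x * (1 - measure_pmf.prob (fair_coins A) G)"
      using measure_pmf.prob_compl[of G "fair_coins A"] by (simp add: Compl_eq_Diff_UNIV)
    finally have "x * measure_pmf.prob (fair_coins A) G = 0"
      by (simp add: algebra_simps)
    moreover have "0 < measure_pmf.prob (fair_coins A) G"
    proof -
      obtain a where a: "a \<in> A" using True by fastforce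
      \<comment> \<open>More than \<open>K \<ge> 1\<close> users means that a second one exists, so
        sending \<open>a\<close> alone to group 1 leaves both groups proper subsets.\<close>
      have "\<not> A \<subseteq> {a}"
        using True assms(1) card_mono[of "{a}" A] by auto
      then have "(\<lambda>u. u = a) \<in> G" using a by (auto simp: G_def)
      moreover have "(\<lambda>u. u = a) \<in> set_pmf (fair_coins A)"
        using a psubset.hyps by (auto simp: fair_coins_def set_Pi_pmf PiE_dflt_def)
      ultimately show ?thesis by (intro measure_pmf_posI)
    qed
    ultimately show ?thesis by (simp add: lossless_iff_pmf_None x_def)
  qed
qed

section \<open>Lower bound and conclusion\<close>

lemma cost_protocol_split:
  assumes "1 \<le> K" "finite A" "K < card A"
  shows "cost (protocol K A) = (\<integral>\<^sup>+ c. 1 + cost (protocol K {u \<in> A. c u})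
           + cost (protocol K {u \<in> A. \<not> c u}) \<partial>measure_pmf (fair_coins A))"
  unfolding protocol_split[OF assms(3)] cost_bind_pmf
  using assms by (simp add: cost_split_slots lossless_protocol)

text \<open>
  The bound is linear in the number of users plus a constant, hence holds for every outcome of the
  coin flips separately. If all users choose the same group, the conditional cost is
  \<open>2 + x\<close> for \<open>x\<close> the cost itself, which is what excludes \<open>x\<close> below the bound.
\<close>

lemma cost_protocol_ge:
  assumes "1 \<le> K" "finite A"
  shows "ennreal (alpha_star K * card A) \<le> cost (protocol K A) + 1"
  using assms(2)
proof (induction A rule: finite_psubset_induct)
  case (psubset A)
  have alpha: "0 \<le> alpha_star K" by (simp add: alpha_star_def)
  show ?case
  proof (cases "K < card A")
    case False
    show ?thesis
    proof (cases "A = {}")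
      case False
      \<comment> \<open>Here \<open>card A / K \<le> 1\<close>, with equality at
        \<open>card A = K\<close>, which fixes the slope \<open>alpha_star K\<close>.\<close>
      have "alpha_star K * card A \<le> card A + 1"
        using \<open>\<not> K < card A\<close> assms(1) by (simp add: alpha_star_def field_simps)
      then have "ennreal (alpha_star K * card A) \<le> ennreal (real (card A) + 1)"
        by (intro ennreal_leI) simp
      then show ?thesis
        using False \<open>\<not> K < card A\<close>
        by (simp add: protocol_small ennreal_of_nat_eq_real_of_nat)
    qed simp
  next
    case True
    define x where "x = cost (protocol K A)"
    define b where "b = ennreal (alpha_star K * card A)"
    define f where
      "f c = 1 + cost (protocol K {u \<in> A. c u}) + cost (protocol K {u \<in> A. \<not> c u})" for c
    have "min b (x + 2 + 1) \<le> f c + 1" for c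
    proof -
      consider "{u \<in> A. c u} \<subset> A" "{u \<in> A. \<not> c u} \<subset> A"
        | "{u \<in> A. c u} = A" "{u \<in> A. \<not> c u} = {}"
        | "{u \<in> A. c u} = {}" "{u \<in> A. \<not> c u} = A"
        by auto
      then show ?thesis
      proof cases
        case 1
        have "card A = card {u \<in> A. c u} + card {u \<in> A. \<not> c u}"
          using psubset.hyps by (simp add: card_split card_mono)
        then have "b = ennreal (alpha_star K * card {u \<in> A. c u})
                     + ennreal (alpha_star K * card {u \<in> A. \<not> c u})"
          using alpha by (simp add: b_def distrib_left ennreal_plus)
        also have "\<dots> \<le> (cost (protocol K {u \<in> A. c u}) + 1)
                           + (cost (protocol K {u \<in> A. \<not> c u}) + 1)"
          by (intro add_mono psubset.IH 1)
        finally show ?thesis by (simp add: f_def ac_simps min.coboundedI1)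
      next
        case 2
        have "f c + 1 = x + 2 + 1" unfolding f_def 2 x_def by (simp add: ac_simps)
        then show ?thesis by simp
      next
        case 3
        have "f c + 1 = x + 2 + 1" unfolding f_def 3 x_def by (simp add: ac_simps)
        then show ?thesis by simp
      qed
    qed
    then have "(\<integral>\<^sup>+ c. min b (x + 2 + 1) \<partial>measure_pmf (fair_coins A))
        \<le> (\<integral>\<^sup>+ c. f c + 1 \<partial>measure_pmf (fair_coins A))"
      by (intro nn_integral_mono)
    also have "\<dots> = x + 1"
      using cost_protocol_split[OF assms(1) psubset.hyps True]
      by (simp add: nn_integral_add x_def f_def)
    finally have min_le: "min b (x + 2 + 1) \<le> x + 1"
      by simp
    \<comment> \<open>The upper bound makes \<open>x\<close> finite, so \<open>x + 2 + 1\<close>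
      exceeds \<open>x + 1\<close> and the minimum has to be \<open>b\<close>.\<close>
    have "x \<noteq> \<top>"
      using cost_protocol_le[OF assms(1) psubset.hyps] by (auto simp: x_def top_unique)
    then have "\<not> x + 2 + 1 \<le> x + 1"
      by (cases x) (auto simp flip: ennreal_plus ennreal_1 ennreal_numeral)
    with min_le show ?thesis by (simp add: min_def b_def x_def split: if_splits)
  qed
qed

text \<open>The two expectations differ only in the value given to \<open>None\<close>, which has
  probability 0 by almost sure termination.\<close>

lemma S_eq_cost:
  assumes "1 \<le> K"
  shows "S K L = cost (protocol K {..<L})"
proof -
  obtain q where q: "protocol K {..<L} = spmf_of_pmf q"
    using lossless_protocol[OF assms, of "{..<L}"] lossless_spmf_conv_spmf_of_pmf by auto
  show ?thesis
    unfolding S_def cost_def q measure_spmf_spmf_of_pmf by (simp add: spmf_of_pmf_def)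
qed

theorem theorem3:
  fixes K :: nat
  assumes "K \<ge> 1"
  shows "(\<forall>L::nat. 1 \<le> L \<and> L \<le> K \<longrightarrow> S K L = of_nat L) \<and>
         (\<forall>L::nat. L > K \<longrightarrow>
            ennreal (alpha_star K * real L - 1) \<le> S K L \<and>
            S K L \<le> ennreal (beta_star K * real L - 1))"
proof (intro conjI allI impI)
  fix L :: nat
  assume "1 \<le> L \<and> L \<le> K"
  moreover from this have "{..<L} \<noteq> {}" by (auto simp: lessThan_empty_iff)
  ultimately show "S K L = of_nat L"
    using assms by (simp add: S_eq_cost protocol_small)
next
  fix L :: nat
  assume L: "L > K"
  have "ennreal (alpha_star K * real L) - 1 \<le> S K L"
    using cost_protocol_ge[OF assms, of "{..<L}"] assms
    by (simp add: S_eq_cost ennreal_minus_le_iff add.commute)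
  then show "ennreal (alpha_star K * real L - 1) \<le> S K L"
    by (metis ennreal_1 ennreal_minus zero_le_one)
next
  fix L :: nat
  assume "L > K"
  then show "S K L \<le> ennreal (beta_star K * real L - 1)"
    using cost_protocol_le[OF assms, of "{..<L}"] assms by (simp add: S_eq_cost slot_bound_def)
qed

end
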